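(* Let $G=(V,E)$ be an infinite connected Eulerian directed graph whose maximal degree $\Delta$ is finite, let $m$ be any rotor mechanism on $G$, and let $X_0\in V$. Suppose that the initial rotor configuration $\rho$ has an infinite path of rotors directed toward $X_0$, i.e. there are distinct vertices $x_0=X_0,x_1,x_2,\dots$ with $\rho(x_i)=(x_i,x_{i-1})$ for all $i\ge1$. Then the simple rotor walk $(X_t)_{t\ge 0}$ started at $X_0$ is transient, and for all $t\ge1$ $$\# R_t\ge \frac{t}{\Delta},\qquad\text{where } R_t=\{X_1,\dots,X_t\}.$$
   Context: For a directed graph $G=(V,E)$ (edges are ordered pairs of vertices) and $v\in V$, let $E_v$ be the set of outgoing edges of $v$, assumed finite and nonempty. $G$ is Eulerian if $\mathrm{indeg}(v)=\mathrm{outdeg}(v)$ for all $v$; this common value is the degree $\deg(v)$, and $\Delta=\max_{v}\deg(v)$. Connected means that the underlying undirected graph is connected. A rotor configuration is a choice of $\rho(v)\in E_v$ for each $v\in V$. A rotor mechanism is a choice, for each $v$, of a cyclic permutation $m(v)$ of $E_v$ (a single cycle through all of $E_v$). Given $\rho$, $m$ and a starting vertex $X_0$, the simple rotor walk is the sequence of vertices $X_0,X_1,\dots$ and rotor configurations $\rho_0=\rho,\rho_1,\dots$ such that for all $t\ge0$: $\rho_{t+1}(X_t)=m(X_t)(\rho_t(X_t))$, $\rho_{t+1}(v)=\rho_t(v)$ for $v\ne X_t$, and $X_{t+1}$ is the target of the edge $\rho_{t+1}(X_t)$. The rotor walk is recurrent if $X_t=X_0$ for infinitely many $t$, and transient otherwise.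 *)

theory Defs
  imports Complex_Main "HOL-Combinatorics.Permutations" "HOL-Combinatorics.Orbits"
    "Graph_Theory.Digraph_Component"
begin

text \<open>
  Digraphs are pairs of a vertex set and a set of ordered pairs of vertices, as in the theory
  Pair_Digraph (loops allowed). For a vertex v, the set of outgoing edges is
  out_arcs (with_proj G) v.
\<close>

text \<open>Finiteness of the in-arcs is explicit because the degrees are defined by card, which is 0
  on infinite sets.\<close>
definition eulerian :: "'a pair_pre_digraph \<Rightarrow> bool" where
  "eulerian G \<longleftrightarrow> (\<forall>v \<in> pverts G.
     finite (in_arcs (with_proj G) v) \<and> finite (out_arcs (with_proj G) v) \<and>
     in_degree (with_proj G) v = out_degree (with_proj G) v)"

text \<open>Meaningful for Eulerian graphs with bounded degrees, where in-degree and out-degree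
  agree.\<close>
definition max_degree :: "'a pair_pre_digraph \<Rightarrow> nat" where
  "max_degree G = Max (out_degree (with_proj G) ` pverts G)"

type_synonym 'a rotors = "'a \<Rightarrow> 'a \<times> 'a"
type_synonym 'a mechanism = "'a \<Rightarrow> 'a \<times> 'a \<Rightarrow> 'a \<times> 'a"

definition rotor_configuration :: "'a pair_pre_digraph \<Rightarrow> 'a rotors \<Rightarrow> bool" where
  "rotor_configuration G \<rho> \<longleftrightarrow> (\<forall>v \<in> pverts G. \<rho> v \<in> out_arcs (with_proj G) v)"

definition rotor_mechanism :: "'a pair_pre_digraph \<Rightarrow> 'a mechanism \<Rightarrow> bool" where
  "rotor_mechanism G m \<longleftrightarrow> (\<forall>v \<in> pverts G.
     m v permutes out_arcs (with_proj G) v \<and> cyclic_on (m v) (out_arcs (with_proj G) v))"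

text \<open>One step: advance the rotor at the current vertex, then follow it to its target.\<close>
definition rotor_step :: "'a mechanism \<Rightarrow> 'a \<times> 'a rotors \<Rightarrow> 'a \<times> 'a rotors" where
  "rotor_step m = (\<lambda>(x, \<rho>). let \<rho>' = \<rho>(x := m x (\<rho> x)) in (snd (\<rho>' x), \<rho>'))"

primrec rotor_state :: "'a mechanism \<Rightarrow> 'a rotors \<Rightarrow> 'a \<Rightarrow> nat \<Rightarrow> 'a \<times> 'a rotors" where
  "rotor_state m \<rho> X0 0 = (X0, \<rho>)"
| "rotor_state m \<rho> X0 (Suc t) = rotor_step m (rotor_state m \<rho> X0 t)"

definition rotor_walk :: "'a mechanism \<Rightarrow> 'a rotors \<Rightarrow> 'a \<Rightarrow> nat \<Rightarrow> 'a" where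
  "rotor_walk m \<rho> X0 t = fst (rotor_state m \<rho> X0 t)"

definition recurrent :: "(nat \<Rightarrow> 'a) \<Rightarrow> bool" where
  "recurrent X \<longleftrightarrow> infinite {t. X t = X 0}"

definition transient :: "(nat \<Rightarrow> 'a) \<Rightarrow> bool" where
  "transient X \<longleftrightarrow> \<not> recurrent X"

end

theory Submission
  imports Defs
begin

text \<open>
  No vertex is ever left more often than its degree. Otherwise consider the first time t at which the
  walk is about to leave some vertex v once too often. So far no edge has been traversed twice, and
  v has been left deg v times. If v differs from the starting vertex, it has been entered
  deg v + 1 times, although it has only deg v incoming edges. If v is the starting vertex, all its
  incoming edges have been used, in particular the one coming from the first vertex of the path.
  As that edge is the initial rotor there, it is the last outgoing edge to be used, so this vertex
  has been left and entered as often as its degree, and its incoming edge on the path has been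
  used as well. Inductively, infinitely many vertices have been visited by time t.
\<close>

text \<open>The orbit of \<open>r\<close> is all of \<open>S\<close>, and an orbit that returns to
  \<open>r\<close> after \<open>n\<close> steps consists of the first \<open>n\<close>
  iterates.\<close>

lemma cyclic_on_funpow_fixpoint_card_le:
  assumes "cyclic_on f S" "r \<in> S" "(f ^^ n) r = r" "0 < n"
  shows "card S \<le> n"
proof -
  have "S = orbit f r"
    using assms(1,2) by (metis orbit_cyclic_eq3)
  also have "\<dots> = (\<lambda>k. (f ^^ k) r) ` {..<n}"
    using orbit_altdef_bounded[OF assms(3,4)] by auto
  finally show ?thesis
    by (metis card_image_le card_lessThan finite_lessThan)
qed

locale eulerian_rotor_walk =
  fixes G :: "'a pair_pre_digraph" and m :: "'a mechanism" and \<rho> :: "'a rotors" and X0 :: 'a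
  assumes wf: "pair_wf_digraph G"
    and eulerian: "eulerian G"
    and mechanism: "rotor_mechanism G m"
    and configuration: "rotor_configuration G \<rho>"
    and start: "X0 \<in> pverts G"
begin

abbreviation deg :: "'a \<Rightarrow> nat" where
  "deg \<equiv> out_degree (with_proj G)"

abbreviation X :: "nat \<Rightarrow> 'a" where
  "X \<equiv> rotor_walk m \<rho> X0"

text \<open>The rotor is read off after the step because it is turned before it is followed: this is
  the edge traversed between times \<open>t\<close> and \<open>t + 1\<close>.\<close>

definition arc :: "nat \<Rightarrow> 'a \<times> 'a" where
  "arc t = snd (rotor_state m \<rho> X0 (Suc t)) (X t)"

definition departures :: "'a \<Rightarrow> nat \<Rightarrow> nat" where
  "departures v t = card {s. s < t \<and> X s = v}"

definition arrivals :: "'a \<Rightarrow> nat \<Rightarrow> nat" where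
  "arrivals v t = card {s. s < t \<and> snd (arc s) = v}"

lemma card_less_Suc_Collect:
  "card {s. s < Suc t \<and> P s} = card {s. s < t \<and> P s} + (if P t then 1 else 0)"
proof -
  have "{s. s < Suc t \<and> P s} = (if P t then insert t else id) {s. s < t \<and> P s}"
    by (auto simp: less_Suc_eq)
  then show ?thesis by simp
qed

lemmas departures_Suc = card_less_Suc_Collect[where P = "\<lambda>s. X s = v" for v, folded departures_def]
lemmas arrivals_Suc = card_less_Suc_Collect[where P = "\<lambda>s. snd (arc s) = v" for v, folded arrivals_def]

lemma departures_0 [simp]: "departures v 0 = 0"
  by (simp add: departures_def)

lemma arrivals_0 [simp]: "arrivals v 0 = 0"
  by (simp add: arrivals_def)

lemma departures_mono: "s \<le> t \<Longrightarrow> departures v s \<le> departures v t"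
  unfolding departures_def by (rule card_mono) auto

lemma walk_0 [simp]: "X 0 = X0"
  by (simp add: rotor_walk_def)

lemma walk_Suc: "X (Suc t) = snd (arc t)"
  by (simp add: rotor_walk_def arc_def rotor_step_def Let_def split: prod.splits)

text \<open>The rotor at \<open>v\<close> turns exactly when the walk leaves \<open>v\<close>, so
  its position depends only on the number of departures.\<close>

lemma rotor_state_eq:
  "snd (rotor_state m \<rho> X0 t) v = (m v ^^ departures v t) (\<rho> v)"
proof (induction t)
  case (Suc t)
  then show ?case
    by (auto simp: departures_Suc rotor_step_def rotor_walk_def Let_def split: prod.splits)
qed simp

lemma arc_eq: "arc t = (m (X t) ^^ departures (X t) (Suc t)) (\<rho> (X t))"
  by (simp only: arc_def rotor_state_eq)

lemma funpow_rotor_in_out_arcs: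
  assumes "v \<in> pverts G"
  shows "(m v ^^ n) (\<rho> v) \<in> out_arcs (with_proj G) v"
proof (induction n)
  case 0
  show ?case using configuration assms by (simp add: rotor_configuration_def)
next
  case (Suc n)
  have "m v permutes out_arcs (with_proj G) v"
    using mechanism assms by (simp add: rotor_mechanism_def)
  with Suc show ?case by (simp only: funpow.simps o_apply permutes_in_image)
qed

lemma walk_in_pverts: "X t \<in> pverts G"
proof (induction t)
  case (Suc t)
  then have "arc t \<in> parcs G"
    unfolding arc_eq using funpow_rotor_in_out_arcs by fastforce
  then show ?case
    using wf by (simp add: walk_Suc pair_wf_digraph.arc_snd_in_verts)
qed (simp add: start)

lemma arc_in_parcs: "arc t \<in> parcs G" and fst_arc: "fst (arc t) = X t"
  using funpow_rotor_in_out_arcs[OF walk_in_pverts[of t]] unfolding arc_eq by (auto simp: out_arcs_def)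

text \<open>Conservation of visits: each visit begins with an arrival or is the start, and ends with
  a departure or is still going on.\<close>

lemma arrivals_departures:
  "arrivals v t + (if X0 = v then 1 else 0) = departures v t + (if X t = v then 1 else 0)"
  by (induction t) (auto simp: departures_Suc arrivals_Suc walk_Suc)

text \<open>Injectivity of \<open>m v\<close> cancels the first \<open>i\<close> turns, so
  \<open>j - i\<close> turns fix the initial rotor; a single cycle allows this only after a full
  turn.\<close>

lemma deg_le_of_rotor_return:
  assumes "v \<in> pverts G" "(m v ^^ i) (\<rho> v) = (m v ^^ j) (\<rho> v)" "i < j"
  shows "deg v \<le> j - i"
proof -
  have perm: "m v permutes out_arcs (with_proj G) v"
    and cyc: "cyclic_on (m v) (out_arcs (with_proj G) v)"
    using mechanism assms(1) by (auto simp: rotor_mechanism_def)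
  have "(m v ^^ i) ((m v ^^ (j - i)) (\<rho> v)) = (m v ^^ i) (\<rho> v)"
    using assms(2,3) by (simp flip: funpow_add o_apply[of "_ ^^ _" "_ ^^ _"])
  moreover have "inj (m v ^^ i)"
    using perm by (intro inj_fn permutes_inj)
  ultimately have "(m v ^^ (j - i)) (\<rho> v) = \<rho> v"
    by (simp add: inj_eq)
  then show ?thesis
    unfolding out_degree_def
    using cyclic_on_funpow_fixpoint_card_le[OF cyc] funpow_rotor_in_out_arcs[OF assms(1), of 0] assms(3)
    by simp
qed

lemma inj_on_arc:
  assumes "\<And>v. v \<in> pverts G \<Longrightarrow> departures v t \<le> deg v"
  shows "inj_on arc {..<t}"
proof (rule linorder_inj_onI')
  fix r s assume "r \<in> {..<t}" "s \<in> {..<t}" and "r < s"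
  show "arc r \<noteq> arc s"
  proof
    assume eq: "arc r = arc s"
    define v where "v = X r"
    have v: "X s = v" "v \<in> pverts G"
      using eq fst_arc[of r] fst_arc[of s] walk_in_pverts[of r] by (simp_all add: v_def)
    \<comment> \<open>The first use of the arc is itself a departure. With the full turn up to the
      second use this makes more than \<open>deg v\<close> departures.\<close>
    have "0 < departures v (Suc r)"
      by (simp add: departures_Suc v_def)
    moreover have less: "departures v (Suc r) < departures v (Suc s)"
      using departures_mono[of "Suc r" s v] \<open>r < s\<close> v by (simp add: departures_Suc[of _ s])
    moreover have "departures v (Suc s) \<le> deg v"
      using departures_mono[of "Suc s" t v] assms[OF v(2)] \<open>s \<in> {..<t}\<close> by simp
    moreover have "deg v \<le> departures v (Suc s) - departures v (Suc r)"
      using eq v less by (intro deg_le_of_rotor_return) (simp_all add: arc_eq v_def)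
    ultimately show False by linarith
  qed
qed

text \<open>Without repetition, arrivals at \<open>v\<close> count distinct incoming arcs, of which
  an Eulerian graph has exactly \<open>deg v\<close>; equality exhausts them.\<close>

lemma
  assumes "inj_on arc {..<t}" "v \<in> pverts G"
  shows arrivals_le: "arrivals v t \<le> deg v"
    and in_arcs_traversed: "arrivals v t = deg v \<Longrightarrow> in_arcs (with_proj G) v \<subseteq> arc ` {..<t}"
proof -
  let ?A = "arc ` {s. s < t \<and> snd (arc s) = v}"
  have "finite (in_arcs (with_proj G) v)" and deg: "card (in_arcs (with_proj G) v) = deg v"
    using eulerian assms(2) by (auto simp: eulerian_def in_degree_def)
  moreover have "?A \<subseteq> in_arcs (with_proj G) v"
    by (auto simp: in_arcs_def arc_in_parcs)
  moreover have "card ?A = arrivals v t"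
    unfolding arrivals_def by (intro card_image inj_on_subset[OF assms(1)]) auto
  ultimately show "arrivals v t \<le> deg v"
    and "arrivals v t = deg v \<Longrightarrow> in_arcs (with_proj G) v \<subseteq> arc ` {..<t}"
    using card_mono[of "in_arcs (with_proj G) v" ?A] card_subset_eq[of "in_arcs (with_proj G) v" ?A]
    by auto
qed

text \<open>Since rotors turn before they are followed, the initial rotor is the last to be used: it
  is iterate 0 and reappears only after a full turn.\<close>

lemma departures_ge_if_rotor_traversed:
  assumes "v \<in> pverts G" "\<rho> v \<in> arc ` {..<t}"
  shows "deg v \<le> departures v t"
proof -
  obtain s where s: "s < t" "arc s = \<rho> v" using assms(2) by auto
  have "fst (\<rho> v) = v"
    using configuration assms(1) by (auto simp: rotor_configuration_def)
  with s have "X s = v" using fst_arc[of s] by simp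
  then have "deg v \<le> departures v (Suc s) - 0"
    using s by (intro deg_le_of_rotor_return[OF assms(1)]) (auto simp: arc_eq departures_Suc)
  also have "\<dots> \<le> departures v t"
    using departures_mono[of "Suc s" t v] s by simp
  finally show ?thesis .
qed

lemma departures_le_deg:
  assumes "x 0 = X0" "inj x" "range x \<subseteq> pverts G" "\<And>i. \<rho> (x (Suc i)) = (x (Suc i), x i)"
    and "v \<in> pverts G"
  shows "departures v t \<le> deg v"
  using assms(5)
proof (induction t arbitrary: v)
  case (Suc t)
  \<comment> \<open>The induction hypothesis bounds all vertices at once, so \<open>t\<close> acts
    as the first time at which some vertex is left too often.\<close>
  have inj: "inj_on arc {..<t}"
    using Suc.IH by (rule inj_on_arc)
  have x: "x i \<in> pverts G" for i using assms(3) by auto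
  show ?case
  proof (rule ccontr)
    assume "\<not> departures v (Suc t) \<le> deg v"
    with Suc.IH[OF Suc.prems] have v: "X t = v" "departures v t = deg v"
      by (auto simp: departures_Suc split: if_splits)
    have "X0 = v"
      using arrivals_departures[of v t] arrivals_le[OF inj Suc.prems] v by (auto split: if_splits)
    have saturated: "departures (x i) t = deg (x i)" for i
    proof (induction i)
      case 0
      show ?case using v \<open>X0 = v\<close> assms(1) by simp
    next
      case (Suc i)
      have "X t = X0" using v \<open>X0 = v\<close> by simp
      \<comment> \<open>As the walk is back at \<open>X0\<close>, the two correction terms in
        \<open>arrivals_departures\<close> agree at every vertex.\<close>
      then have "arrivals (x i) t = deg (x i)"
        using arrivals_departures[of "x i" t] Suc.IH by simp
      then have "in_arcs (with_proj G) (x i) \<subseteq> arc ` {..<t}"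
        by (rule in_arcs_traversed[OF inj x])
      moreover have "\<rho> (x (Suc i)) \<in> in_arcs (with_proj G) (x i)"
        using configuration x[of "Suc i"] assms(4)[of i] by (auto simp: rotor_configuration_def)
      ultimately show ?case
        using departures_ge_if_rotor_traversed[OF x, of "Suc i" t] \<open>\<And>v. v \<in> pverts G \<Longrightarrow> departures v t \<le> deg v\<close>[OF x]
        by (meson antisym subsetD)
    qed
    \<comment> \<open>Saturation implies a visit only where the degree is positive; the rotor itself
      is an outgoing arc, so every \<open>x i\<close> was left before time \<open>t\<close>.\<close>
    have "range x \<subseteq> X ` {..<t}"
    proof
      fix u assume "u \<in> range x"
      then obtain i where i: "u = x i" by blast
      have "\<rho> u \<in> out_arcs (with_proj G) u" "finite (out_arcs (with_proj G) u)"
        using configuration eulerian x i by (auto simp: rotor_configuration_def eulerian_def)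
      then have "deg u > 0"
        unfolding out_degree_def by (auto simp: card_gt_0_iff)
      then have "{s. s < t \<and> X s = u} \<noteq> {}"
        using saturated[of i] unfolding i departures_def by (metis card.empty less_irrefl)
      then show "u \<in> X ` {..<t}" by auto
    qed
    then have "finite (range x)" by (rule finite_subset) simp
    with assms(2) show False by (simp add: finite_image_iff)
  qed
qed simp

end

theorem theorem1p2:
  fixes G :: "'a pair_pre_digraph"
    and m :: "'a mechanism"
    and \<rho> :: "'a rotors"
    and X0 :: 'a
  assumes "pair_wf_digraph G"
    and "infinite (pverts G)"
    and "\<And>v. v \<in> pverts G \<Longrightarrow>
          finite (out_arcs (with_proj G) v) \<and> out_arcs (with_proj G) v \<noteq> {}"
    and "Digraph_Component.connected (with_proj G)"
    and "eulerian G"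
    and "bdd_above (out_degree (with_proj G) ` pverts G)"
    and "rotor_mechanism G m"
    and "rotor_configuration G \<rho>"
    and "X0 \<in> pverts G"
    and "\<exists>x :: nat \<Rightarrow> 'a. x 0 = X0 \<and> inj x \<and> range x \<subseteq> pverts G \<and>
          (\<forall>i\<ge>1. \<rho> (x i) = (x i, x (i - 1)))"
  shows "transient (rotor_walk m \<rho> X0) \<and>
         (\<forall>t\<ge>1. real (card (rotor_walk m \<rho> X0 ` {1..t})) \<ge> real t / real (max_degree G))"
proof -
  interpret eulerian_rotor_walk G m \<rho> X0
    using assms by (intro eulerian_rotor_walk.intro)
  obtain x :: "nat \<Rightarrow> 'a" where x: "x 0 = X0" "inj x" "range x \<subseteq> pverts G"
    and path: "\<forall>i\<ge>1. \<rho> (x i) = (x i, x (i - 1))"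
    using assms(10) by blast
  have bound: "departures v t \<le> deg v" if "v \<in> pverts G" for v t
    using path that by (intro departures_le_deg[OF x]) auto
  have "transient X"
    unfolding transient_def recurrent_def
  proof
    assume "infinite {t. X t = X 0}"
    \<comment> \<open>One visit to \<open>X0\<close> more than its degree suffices; by time
      \<open>Suc (Max F)\<close> all of them have ended in departures.\<close>
    then obtain F where F: "finite F" "card F = Suc (deg X0)" "F \<subseteq> {t. X t = X0}"
      using infinite_arbitrarily_large[of "{t. X t = X0}" "Suc (deg X0)"] by auto
    then have "F \<subseteq> {s. s < Suc (Max F) \<and> X s = X0}"
      by (auto simp: less_Suc_eq_le)
    then have "card F \<le> departures X0 (Suc (Max F))"
      unfolding departures_def by (intro card_mono) auto
    with F(2) bound[OF start, of "Suc (Max F)"] show False by simp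
  qed
  moreover have "real t / real (max_degree G) \<le> real (card (X ` {1..t}))" for t
  proof -
    have fin: "finite (deg ` pverts G)"
      using assms(6) by (simp add: bdd_above_nat)
    have "card {s \<in> {1..t}. X s = v} \<le> max_degree G" if "v \<in> X ` {1..t}" for v
    proof -
      have v: "v \<in> pverts G" using that walk_in_pverts by auto
      have "card {s \<in> {1..t}. X s = v} \<le> departures v (Suc t)"
        unfolding departures_def by (rule card_mono) auto
      also have "\<dots> \<le> deg v" by (rule bound[OF v])
      also have "\<dots> \<le> max_degree G"
        unfolding max_degree_def using fin v by (intro Max_ge) auto
      finally show ?thesis .
    qed
    then have "(\<Sum>v\<in>X ` {1..t}. card {s \<in> {1..t}. X s = v}) \<le> card (X ` {1..t}) * max_degree G"
      using sum_bounded_above[of "X ` {1..t}" _ "max_degree G"] by simp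
    moreover have "(\<Sum>v\<in>X ` {1..t}. card {s \<in> {1..t}. X s = v}) = t"
      using sum.image_gen[of "{1..t}" "\<lambda>_. 1::nat" X] by simp
    ultimately have "real t \<le> real (card (X ` {1..t})) * real (max_degree G)"
      by (simp flip: of_nat_mult)
    then show ?thesis
      by (cases "max_degree G = 0") (simp_all add: pos_divide_le_eq)
  qed
  ultimately show ?thesis by blast
qed

end
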